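(* Let $\mathcal{H}_{\rm S}$ be a finite-dimensional complex Hilbert space with identity operator $I$, and let $\mathcal{E}$ be a nonunital quantum channel on $\mathcal{H}_{\rm S}$, i.e. $\mathcal{E}[I]\neq I$. Then $\mathcal{E}$ is not repeatable with finite memory.
   Context: A state on a Hilbert space is a density operator (positive trace-class operator of unit trace). A quantum channel on $\mathcal{H}_{\rm S}$ is a completely positive trace-preserving linear map $\mathcal{E}$ on the trace-class operators on $\mathcal{H}_{\rm S}$. Let $\mathcal{H}_{\rm M}$ be a complex Hilbert space (the memory), $U$ a unitary operator on $\mathcal{H}_{\rm M}\otimes\mathcal{H}_{\rm S}$, and $\xi$ a state on $\mathcal{H}_{\rm M}$ (the initial memory state). Given a sequence of input states $\varrho_1,\varrho_2,\dots$ on $\mathcal{H}_{\rm S}$ (the inputs are uncorrelated with each other and the same $U$ is applied at each use of the device, with no reset of the memory), define the memory states recursively by $\xi_1=\xi$ and $\xi_{j+1}=\mathrm{Tr}_{\rm S}[U(\xi_j\otimes\varrho_j)U^\dagger]$. The channel induced at the $j$-th use is $\mathcal{E}_j[\varrho]=\mathrm{Tr}_{\rm M}[U(\xi_j\otimes\varrho)U^\dagger]$. Here $\mathrm{Tr}_{\rm M}$ and $\mathrm{Tr}_{\rm S}$ denote the partial traces over $\mathcal{H}_{\rm M}$ and $\mathcal{H}_{\rm S}$. In general $\mathcal{E}_j$ depends on $\varrho_1,\dots,\varrho_{j-1}$. A quantum channel $\mathcal{E}$ is called repeatable if there exist a memory space $\mathcal{H}_{\rm M}$, a unitary $U$ on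 $\mathcal{H}_{\rm M}\otimes\mathcal{H}_{\rm S}$ and a state $\xi$ on $\mathcal{H}_{\rm M}$ such that, for every choice of input states $\varrho_1,\varrho_2,\dots$, one has $\mathcal{E}_1=\dots=\mathcal{E}_n=\mathcal{E}$ for all $n>0$. It is repeatable with finite memory if such $\mathcal{H}_{\rm M}$, $U$, $\xi$ exist with $\dim\mathcal{H}_{\rm M}<\infty$. *)

theory Defs
  imports "Jordan_Normal_Form.Schur_Decomposition"
begin

text \<open>
  An \<open>n\<close>-dimensional complex Hilbert space is represented by its coordinate space
  \<open>carrier_vec n\<close> over the complex numbers with inner product \<open>\<bullet>c\<close>, and the operators on it
  (all of them trace-class) by \<open>carrier_mat n n\<close>. In a tensor product of spaces of
  dimensions \<open>m\<close> and \<open>d\<close>, the basis vector \<open>e\<^sub>i \<otimes> f\<^sub>s\<close> has index \<open>i * d + s\<close>; the memory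
  is always the left factor and the system the right one.
\<close>

(* The order on complex is the one of HOL-Library.Complex_Order, where 0 \<le> z includes
   that z is real; hence a positive operator is in particular self-adjoint. *)
definition positive_op :: "nat \<Rightarrow> complex mat \<Rightarrow> bool" where
  "positive_op n A \<longleftrightarrow>
     A \<in> carrier_mat n n \<and> (\<forall>v \<in> carrier_vec n. 0 \<le> (A *\<^sub>v v) \<bullet>c v)"

definition trace_op :: "complex mat \<Rightarrow> complex" where
  "trace_op A = (\<Sum>i<dim_row A. A $$ (i, i))"

definition density_op :: "nat \<Rightarrow> complex mat \<Rightarrow> bool" where
  "density_op n \<rho> \<longleftrightarrow> positive_op n \<rho> \<and> trace_op \<rho> = 1"

definition unitary_op :: "nat \<Rightarrow> complex mat \<Rightarrow> bool" where
  "unitary_op n U \<longleftrightarrow>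
     U \<in> carrier_mat n n \<and> mat_adjoint U * U = 1\<^sub>m n \<and> U * mat_adjoint U = 1\<^sub>m n"

definition tensor_op :: "complex mat \<Rightarrow> complex mat \<Rightarrow> complex mat" where
  "tensor_op A B =
     mat (dim_row A * dim_row B) (dim_col A * dim_col B)
       (\<lambda>(p, q). A $$ (p div dim_row B, q div dim_col B) * B $$ (p mod dim_row B, q mod dim_col B))"

definition ptrace_M :: "nat \<Rightarrow> nat \<Rightarrow> complex mat \<Rightarrow> complex mat" where
  "ptrace_M m d X = mat d d (\<lambda>(s, t). \<Sum>i<m. X $$ (i * d + s, i * d + t))"

definition ptrace_S :: "nat \<Rightarrow> nat \<Rightarrow> complex mat \<Rightarrow> complex mat" where
  "ptrace_S m d X = mat m m (\<lambda>(i, j). \<Sum>s<d. X $$ (i * d + s, j * d + s))"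

definition block_op :: "nat \<Rightarrow> nat \<Rightarrow> nat \<Rightarrow> complex mat \<Rightarrow> complex mat" where
  "block_op d a b X = mat d d (\<lambda>(s, t). X $$ (a * d + s, b * d + t))"

(* The map id \<otimes> E, where id acts on k-by-k matrices: E is applied to each of the k * k
   blocks of size d, i.e. it sends (\<Sum>a b. e_ab \<otimes> X_ab) to (\<Sum>a b. e_ab \<otimes> E X_ab). *)
definition ampliation ::
    "nat \<Rightarrow> nat \<Rightarrow> (complex mat \<Rightarrow> complex mat) \<Rightarrow> complex mat \<Rightarrow> complex mat" where
  "ampliation k d E X =
     mat (k * d) (k * d) (\<lambda>(p, q). E (block_op d (p div d) (q div d) X) $$ (p mod d, q mod d))"

definition linear_superop :: "nat \<Rightarrow> (complex mat \<Rightarrow> complex mat) \<Rightarrow> bool" where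
  "linear_superop d E \<longleftrightarrow>
     (\<forall>X \<in> carrier_mat d d. E X \<in> carrier_mat d d) \<and>
     (\<forall>X \<in> carrier_mat d d. \<forall>Y \<in> carrier_mat d d. E (X + Y) = E X + E Y) \<and>
     (\<forall>c. \<forall>X \<in> carrier_mat d d. E (c \<cdot>\<^sub>m X) = c \<cdot>\<^sub>m E X)"

definition completely_positive :: "nat \<Rightarrow> (complex mat \<Rightarrow> complex mat) \<Rightarrow> bool" where
  "completely_positive d E \<longleftrightarrow>
     (\<forall>k X. positive_op (k * d) X \<longrightarrow> positive_op (k * d) (ampliation k d E X))"

definition trace_preserving :: "nat \<Rightarrow> (complex mat \<Rightarrow> complex mat) \<Rightarrow> bool" where
  "trace_preserving d E \<longleftrightarrow> (\<forall>X \<in> carrier_mat d d. trace_op (E X) = trace_op X)"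

definition quantum_channel :: "nat \<Rightarrow> (complex mat \<Rightarrow> complex mat) \<Rightarrow> bool" where
  "quantum_channel d E \<longleftrightarrow>
     linear_superop d E \<and> completely_positive d E \<and> trace_preserving d E"

definition evolve :: "complex mat \<Rightarrow> complex mat \<Rightarrow> complex mat \<Rightarrow> complex mat" where
  "evolve U \<xi> \<rho> = U * tensor_op \<xi> \<rho> * mat_adjoint U"

(* Uses of the device are counted from 0: \<rho> 0 is the first input, and
   memory_state m d U \<xi> \<rho> j is the memory just before the input \<rho> j. *)
primrec memory_state ::
    "nat \<Rightarrow> nat \<Rightarrow> complex mat \<Rightarrow> complex mat \<Rightarrow> (nat \<Rightarrow> complex mat) \<Rightarrow> nat \<Rightarrow> complex mat" where
  "memory_state m d U \<xi> \<rho> 0 = \<xi>"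
| "memory_state m d U \<xi> \<rho> (Suc j) = ptrace_S m d (evolve U (memory_state m d U \<xi> \<rho> j) (\<rho> j))"

definition induced_channel ::
    "nat \<Rightarrow> nat \<Rightarrow> complex mat \<Rightarrow> complex mat \<Rightarrow> (nat \<Rightarrow> complex mat) \<Rightarrow> nat \<Rightarrow>
      complex mat \<Rightarrow> complex mat" where
  "induced_channel m d U \<xi> \<rho> j X = ptrace_M m d (evolve U (memory_state m d U \<xi> \<rho> j) X)"

definition repeatable_finite_memory :: "nat \<Rightarrow> (complex mat \<Rightarrow> complex mat) \<Rightarrow> bool" where
  "repeatable_finite_memory d E \<longleftrightarrow>
     (\<exists>m U \<xi>. unitary_op (m * d) U \<and> density_op m \<xi> \<and>
       (\<forall>\<rho>. (\<forall>j. density_op d (\<rho> j)) \<longrightarrow>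
         (\<forall>j. \<forall>X \<in> carrier_mat d d. induced_channel m d U \<xi> \<rho> j X = E X)))"

end

theory Submission
  imports Defs
begin

text \<open>
  Feed the maximally mixed state \<open>I / d\<close> at every use. With \<open>Y\<^sub>j = U (\<xi>\<^sub>j \<otimes> I) U\<^sup>*\<close> the next
  memory state is \<open>\<xi>\<^sub>j\<^sub>+\<^sub>1 = Tr\<^sub>S Y\<^sub>j / d\<close>, and \<open>\<xi>\<^sub>j\<^sub>+\<^sub>1 \<otimes> I\<close> is the Hilbert--Schmidt orthogonal
  projection of \<open>Y\<^sub>j\<close> onto the operators \<open>A \<otimes> I\<close>. By unitary invariance and Pythagoras,
  the squared norm of \<open>Y\<^sub>j - \<xi>\<^sub>j\<^sub>+\<^sub>1 \<otimes> I\<close> is \<open>d\<close> times the drop of the purity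
  \<open>\<parallel>\<xi>\<^sub>j\<parallel>\<^sup>2 - \<parallel>\<xi>\<^sub>j\<^sub>+\<^sub>1\<parallel>\<^sup>2\<close>. The purities decrease and are bounded below, so these differences
  tend to zero, and hence so does \<open>Tr\<^sub>M (Y\<^sub>j - \<xi>\<^sub>j\<^sub>+\<^sub>1 \<otimes> I)\<close>. Repeatability says that the latter
  is the constant \<open>E I - I\<close>.
\<close>

section \<open>Adjoints, the trace and its unitary invariance\<close>

lemma dim_mat_adjoint [simp]:
  "dim_row (mat_adjoint A) = dim_col A" "dim_col (mat_adjoint A) = dim_row A"
  by (simp_all add: mat_adjoint_def)

lemma mat_adjoint_carrier [simp]:
  "A \<in> carrier_mat n m \<Longrightarrow> mat_adjoint A \<in> carrier_mat m n"
  by (rule carrier_matI) auto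

lemma index_mat_adjoint [simp]:
  assumes "i < dim_col A" "j < dim_row A"
  shows "mat_adjoint A $$ (i, j) = conjugate (A $$ (j, i))"
  using assms by (simp add: mat_adjoint_def mat_of_rows_index)

lemma mat_adjoint_mult:
  fixes A B :: "complex mat"
  assumes "A \<in> carrier_mat n k" "B \<in> carrier_mat k m"
  shows "mat_adjoint (A * B) = mat_adjoint B * mat_adjoint A"
  using assms by (intro eq_matI) (auto simp: scalar_prod_def mult.commute intro!: sum.cong)

lemma mat_adjoint_mat_adjoint [simp]:
  fixes A :: "complex mat"
  shows "mat_adjoint (mat_adjoint A) = A"
  by (intro eq_matI) auto

lemma trace_op_mult_comm:
  assumes "A \<in> carrier_mat n k" "B \<in> carrier_mat k n"
  shows "trace_op (A * B) = trace_op (B * A)"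
proof -
  have "trace_op (A * B) = (\<Sum>i<n. \<Sum>l<k. A $$ (i, l) * B $$ (l, i))"
    using assms by (auto simp: trace_op_def scalar_prod_def lessThan_atLeast0)
  also have "\<dots> = (\<Sum>l<k. \<Sum>i<n. B $$ (l, i) * A $$ (i, l))"
    by (subst sum.swap) (simp add: mult.commute)
  also have "\<dots> = trace_op (B * A)"
    using assms by (auto simp: trace_op_def scalar_prod_def lessThan_atLeast0)
  finally show ?thesis .
qed

lemma trace_op_unitary_conj:
  assumes "unitary_op n U" "A \<in> carrier_mat n n"
  shows "trace_op (U * A * mat_adjoint U) = trace_op A"
proof -
  have U: "U \<in> carrier_mat n n" "mat_adjoint U \<in> carrier_mat n n" "mat_adjoint U * U = 1\<^sub>m n"
    using assms(1) by (auto simp: unitary_op_def)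
  have "trace_op (U * A * mat_adjoint U) = trace_op (mat_adjoint U * (U * A))"
    using U assms(2) by (intro trace_op_mult_comm[of _ n n]) auto
  also have "mat_adjoint U * (U * A) = mat_adjoint U * U * A"
    using U(1,2) assms(2) by (simp add: assoc_mult_mat[of _ n n _ n _ n])
  finally show ?thesis by (simp only: U(3) left_mult_one_mat[OF assms(2)])
qed

section \<open>The squared Hilbert-Schmidt norm\<close>

definition frobenius_sq :: "complex mat \<Rightarrow> real" where
  "frobenius_sq A = (\<Sum>i<dim_row A. \<Sum>j<dim_col A. (cmod (A $$ (i, j)))\<^sup>2)"

lemma frobenius_sq_nonneg: "0 \<le> frobenius_sq A"
  by (simp add: frobenius_sq_def sum_nonneg)

text \<open>Turns convergence to zero in norm into convergence of every entry.\<close>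

lemma cmod_entry_le_frobenius_sq:
  assumes "i < dim_row A" "j < dim_col A"
  shows "(cmod (A $$ (i, j)))\<^sup>2 \<le> frobenius_sq A"
proof -
  have "(cmod (A $$ (i, j)))\<^sup>2 \<le> (\<Sum>j<dim_col A. (cmod (A $$ (i, j)))\<^sup>2)"
    using assms by (intro member_le_sum) auto
  also have "\<dots> \<le> frobenius_sq A"
    unfolding frobenius_sq_def using assms
    by (intro member_le_sum[of i _ "\<lambda>i. \<Sum>j<dim_col A. (cmod (A $$ (i, j)))\<^sup>2"]) (auto intro: sum_nonneg)
  finally show ?thesis .
qed

text \<open>In this form unitary invariance of the norm follows from that of the trace.\<close>

lemma of_real_frobenius_sq: "complex_of_real (frobenius_sq A) = trace_op (A * mat_adjoint A)"
  by (auto simp: frobenius_sq_def trace_op_def scalar_prod_def lessThan_atLeast0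
      complex_norm_square[symmetric] simp del: of_real_power intro!: sum.cong)

lemma frobenius_sq_unitary_conj:
  assumes "unitary_op n U" "A \<in> carrier_mat n n"
  shows "frobenius_sq (U * A * mat_adjoint U) = frobenius_sq A"
proof -
  have U: "U \<in> carrier_mat n n" "mat_adjoint U \<in> carrier_mat n n" "mat_adjoint U * U = 1\<^sub>m n"
    using assms(1) by (auto simp: unitary_op_def)
  note A = assms(2) mat_adjoint_carrier[OF assms(2)]
  note assoc = assoc_mult_mat[of _ n n _ n _ n] mult_carrier_mat[of _ n n _ n]
  have adj: "mat_adjoint (U * A * mat_adjoint U) = U * mat_adjoint A * mat_adjoint U"
    using U A by (simp add: mat_adjoint_mult[of _ n n _ n] assoc)
  have "U * A * mat_adjoint U * (U * mat_adjoint A * mat_adjoint U)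
      = U * A * (mat_adjoint U * U) * mat_adjoint A * mat_adjoint U"
    using U(1,2) A by (simp add: assoc)
  also have "\<dots> = U * (A * mat_adjoint A) * mat_adjoint U"
    unfolding U(3) using U(1,2) A by (simp add: assoc)
  finally have "complex_of_real (frobenius_sq (U * A * mat_adjoint U)) = complex_of_real (frobenius_sq A)"
    using trace_op_unitary_conj[OF assms(1), of "A * mat_adjoint A"] A
    by (simp add: of_real_frobenius_sq adj)
  then show ?thesis by simp
qed

section \<open>Block indices, tensor products and partial traces\<close>

lemma sum_lessThan_mult:
  fixes f :: "nat \<Rightarrow> 'a :: comm_monoid_add"
  shows "(\<Sum>p<m * d. f p) = (\<Sum>i<m. \<Sum>s<d. f (i * d + s))"
proof -
  have "(\<Sum>s<d. f (i * d + s)) = sum f {i * d..<i * d + d}" for i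
    using sum.atLeastLessThan_shift_0[of f "i * d" "i * d + d"]
    by (simp only: atLeast0LessThan comp_def diff_add_inverse)
  then show ?thesis
    using sum.nat_group[of f d m] by simp
qed

lemma mult_add_less:
  fixes i s m d :: nat
  assumes "i < m" "s < d"
  shows "i * d + s < m * d"
  proof -
  have "i * d + s < Suc i * d" using assms(2) by simp
  also have "\<dots> \<le> m * d" using assms(1) by (intro mult_le_mono1) simp
  finally show ?thesis .
qed

lemma frobenius_sq_blocks:
  assumes "A \<in> carrier_mat (m * d) (m * d)"
  shows "frobenius_sq A
    = (\<Sum>i<m. \<Sum>j<m. \<Sum>s<d. \<Sum>t<d. (cmod (A $$ (i * d + s, j * d + t)))\<^sup>2)"
  using assms by (auto simp: frobenius_sq_def sum_lessThan_mult intro!: sum.cong sum.swap)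

lemma trace_op_blocks:
  assumes "A \<in> carrier_mat (m * d) (m * d)"
  shows "trace_op A = (\<Sum>i<m. \<Sum>s<d. A $$ (i * d + s, i * d + s))"
  using assms by (auto simp: trace_op_def sum_lessThan_mult)

lemma tensor_op_carrier [simp]:
  "A \<in> carrier_mat m m \<Longrightarrow> B \<in> carrier_mat d d \<Longrightarrow> tensor_op A B \<in> carrier_mat (m * d) (m * d)"
  by (auto simp: tensor_op_def)

lemma index_tensor_op:
  assumes "A \<in> carrier_mat m m" "B \<in> carrier_mat d d" "i < m" "j < m" "s < d" "t < d"
  shows "tensor_op A B $$ (i * d + s, j * d + t) = A $$ (i, j) * B $$ (s, t)"
  using assms by (simp add: tensor_op_def mult_add_less)

lemma tensor_op_smult_right:
  assumes "A \<in> carrier_mat m m" "B \<in> carrier_mat d d"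
  shows "tensor_op A (c \<cdot>\<^sub>m B) = c \<cdot>\<^sub>m tensor_op A B"
proof (intro eq_matI)
  fix p q assume "p < dim_row (c \<cdot>\<^sub>m tensor_op A B)" "q < dim_col (c \<cdot>\<^sub>m tensor_op A B)"
  then have *: "p < m * d" "q < m * d" using assms by (auto simp: tensor_op_def)
  \<comment> \<open>Positivity of \<open>d\<close> makes \<open>p mod d\<close> and
    \<open>q mod d\<close> valid indices of \<open>B\<close>.\<close>
  then have "d > 0" by (cases d) auto
  with * show "tensor_op A (c \<cdot>\<^sub>m B) $$ (p, q) = (c \<cdot>\<^sub>m tensor_op A B) $$ (p, q)"
    using assms by (simp add: tensor_op_def)
qed (use assms in \<open>auto simp: tensor_op_def\<close>)

lemma evolve_carrier [simp]:
  assumes "unitary_op (m * d) U" "A \<in> carrier_mat m m" "B \<in> carrier_mat d d"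
  shows "evolve U A B \<in> carrier_mat (m * d) (m * d)"
  using assms by (auto simp: evolve_def unitary_op_def intro!: mult_carrier_mat)

lemma evolve_smult_right:
  assumes "unitary_op (m * d) U" "A \<in> carrier_mat m m" "B \<in> carrier_mat d d"
  shows "evolve U A (c \<cdot>\<^sub>m B) = c \<cdot>\<^sub>m evolve U A B"
proof -
  have U: "U \<in> carrier_mat (m * d) (m * d)" "mat_adjoint U \<in> carrier_mat (m * d) (m * d)"
    using assms(1) by (auto simp: unitary_op_def)
  have T: "tensor_op A B \<in> carrier_mat (m * d) (m * d)" using assms by simp
  then show ?thesis
    unfolding evolve_def tensor_op_smult_right[OF assms(2,3)]
    using U mult_smult_distrib[OF U(1) T, of c]
      mult_smult_assoc_mat[OF mult_carrier_mat[OF U(1) T] U(2), of c] by simp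
qed

lemma ptrace_S_smult:
  assumes "Y \<in> carrier_mat (m * d) (m * d)"
  shows "ptrace_S m d (c \<cdot>\<^sub>m Y) = c \<cdot>\<^sub>m ptrace_S m d Y"
  using assms by (intro eq_matI) (auto simp: ptrace_S_def mult_add_less sum_distrib_left intro!: sum.cong)

lemma trace_op_ptrace_S:
  assumes "Y \<in> carrier_mat (m * d) (m * d)"
  shows "trace_op (ptrace_S m d Y) = trace_op Y"
  using assms by (simp add: trace_op_blocks) (simp add: trace_op_def ptrace_S_def)

lemma trace_op_tensor_op:
  assumes "A \<in> carrier_mat m m" "B \<in> carrier_mat d d"
  shows "trace_op (tensor_op A B) = trace_op A * trace_op B"
proof -
  have "trace_op (tensor_op A B) = (\<Sum>i<m. \<Sum>s<d. A $$ (i, i) * B $$ (s, s))"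
    using assms by (simp add: trace_op_blocks[of _ m d] index_tensor_op)
  then show ?thesis using assms by (simp add: trace_op_def sum_product)
qed

text \<open>Pythagoras for a single block \<open>y\<close>: its orthogonal projection onto the
  multiples of the identity is \<open>w\<close> times the identity, with \<open>w\<close> the
  normalized trace, and that projection has squared norm \<open>d\<close> times the squared modulus
  of \<open>w\<close>.\<close>

lemma sum_cmod_sq_diag:
  assumes "d > (0 :: nat)"
  shows "(\<Sum>s<d. \<Sum>t<d. (cmod (y s t - (if s = t then (\<Sum>r<d. y r r) / of_nat d else 0)))\<^sup>2)
    = (\<Sum>s<d. \<Sum>t<d. (cmod (y s t))\<^sup>2) - (cmod (\<Sum>r<d. y r r))\<^sup>2 / real d"
proof -
  define z where "z = (\<Sum>r<d. y r r)"
  define w where "w = z / of_nat d"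
  have w: "z = of_nat d * w" using assms by (simp add: w_def)
  have zw: "(\<Sum>r<d. Re (y r r)) = real d * Re w" "(\<Sum>r<d. Im (y r r)) = real d * Im w"
    using arg_cong[OF w, of Re] arg_cong[OF w, of Im] by (simp_all add: z_def Re_sum Im_sum)
  \<comment> \<open>The cross term is written through real and imaginary parts, so it is real-linear
    in \<open>a\<close> and its sum over the diagonal is given by \<open>zw\<close>.\<close>
  have cmod_diff: "(cmod (a - w))\<^sup>2 = (cmod a)\<^sup>2 + ((cmod w)\<^sup>2 - 2 * Re w * Re a - 2 * Im w * Im a)" for a
    unfolding cmod_power2 by (simp add: power2_eq_square algebra_simps)
  have "(\<Sum>s<d. \<Sum>t<d. (cmod (y s t - (if s = t then w else 0)))\<^sup>2)
      = (\<Sum>s<d. \<Sum>t<d. (cmod (y s t))\<^sup>2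
          + (if s = t then (cmod w)\<^sup>2 - 2 * Re w * Re (y s t) - 2 * Im w * Im (y s t) else 0))"
    by (intro sum.cong) (auto simp: cmod_diff)
  also have "\<dots> = (\<Sum>s<d. \<Sum>t<d. (cmod (y s t))\<^sup>2)
      + (\<Sum>s<d. (cmod w)\<^sup>2 - 2 * Re w * Re (y s s) - 2 * Im w * Im (y s s))"
    by (simp add: sum.distrib sum.delta')
  also have "(\<Sum>s<d. (cmod w)\<^sup>2 - 2 * Re w * Re (y s s) - 2 * Im w * Im (y s s))
      = real d * (cmod w)\<^sup>2 - 2 * Re w * (\<Sum>s<d. Re (y s s)) - 2 * Im w * (\<Sum>s<d. Im (y s s))"
    by (simp add: sum_subtractf sum_distrib_left)
  \<comment> \<open>By \<open>zw\<close> the two cross terms add up to twice the positive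
    term.\<close>
  also have "\<dots> = - (real d * (cmod w)\<^sup>2)"
    unfolding zw cmod_power2 by (simp add: power2_eq_square algebra_simps)
  also have "real d * (cmod w)\<^sup>2 = (cmod z)\<^sup>2 / real d"
    using assms by (simp add: w_def norm_divide power2_eq_square)
  finally show ?thesis unfolding w_def z_def by simp
qed

text \<open>
  Pythagoras for the Hilbert--Schmidt orthogonal projection of \<open>Y\<close> onto the operators of the
  form \<open>A \<otimes> I\<close>.
\<close>

lemma frobenius_sq_diff_tensor:
  assumes "d > 0" "Y \<in> carrier_mat (m * d) (m * d)"
  defines "Z \<equiv> (1 / of_nat d) \<cdot>\<^sub>m ptrace_S m d Y"
  shows "frobenius_sq (Y - tensor_op Z (1\<^sub>m d)) = frobenius_sq Y - real d * frobenius_sq Z"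
proof -
  have Z: "Z \<in> carrier_mat m m" by (simp add: Z_def ptrace_S_def)
  have Zij: "Z $$ (i, j) = (\<Sum>r<d. Y $$ (i * d + r, j * d + r)) / of_nat d" if "i < m" "j < m" for i j
    using that by (simp add: Z_def ptrace_S_def)
  have T: "tensor_op Z (1\<^sub>m d) \<in> carrier_mat (m * d) (m * d)" using Z by simp
  then have YT: "Y - tensor_op Z (1\<^sub>m d) \<in> carrier_mat (m * d) (m * d)" by (rule minus_carrier_mat)
  have "frobenius_sq (Y - tensor_op Z (1\<^sub>m d)) = (\<Sum>i<m. \<Sum>j<m. \<Sum>s<d. \<Sum>t<d.
      (cmod (Y $$ (i * d + s, j * d + t) -
        (if s = t then (\<Sum>r<d. Y $$ (i * d + r, j * d + r)) / of_nat d else 0)))\<^sup>2)"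
    unfolding frobenius_sq_blocks[OF YT] using assms(2) Z T
    by (intro sum.cong refl) (simp add: mult_add_less index_tensor_op[of _ m _ d] Zij carrier_matD[OF T])
  \<comment> \<open>Each block of \<open>tensor_op Z (1\<^sub>m d)\<close> is the projection of the
    corresponding block of \<open>Y\<close> onto the multiples of the identity, so the single-block
    identity applies to every pair \<open>i\<close>, \<open>j\<close>.\<close>
  also have "\<dots> = (\<Sum>i<m. \<Sum>j<m. (\<Sum>s<d. \<Sum>t<d. (cmod (Y $$ (i * d + s, j * d + t)))\<^sup>2)
      - (cmod (\<Sum>r<d. Y $$ (i * d + r, j * d + r)))\<^sup>2 / real d)"
    using sum_cmod_sq_diag[OF assms(1), of "\<lambda>s t. Y $$ (_ * d + s, _ * d + t)"] by simp
  also have "\<dots> = frobenius_sq Y - (\<Sum>i<m. \<Sum>j<m. (cmod (\<Sum>r<d. Y $$ (i * d + r, j * d + r)))\<^sup>2 / real d)"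
    using assms(2) by (simp add: frobenius_sq_blocks sum_subtractf)
  also have "(\<Sum>i<m. \<Sum>j<m. (cmod (\<Sum>r<d. Y $$ (i * d + r, j * d + r)))\<^sup>2 / real d)
      = real d * frobenius_sq Z"
    using Z assms(1)
    by (simp add: frobenius_sq_def sum_distrib_left Zij norm_divide power2_eq_square)
  finally show ?thesis .
qed

lemma frobenius_sq_tensor_one:
  assumes "A \<in> carrier_mat m m"
  shows "frobenius_sq (tensor_op A (1\<^sub>m d)) = real d * frobenius_sq A"
proof -
  have "frobenius_sq (tensor_op A (1\<^sub>m d))
      = (\<Sum>i<m. \<Sum>j<m. \<Sum>s<d. \<Sum>t<d. if s = t then (cmod (A $$ (i, j)))\<^sup>2 else 0)"
    using assms by (subst frobenius_sq_blocks[of _ m d]) (simp, intro sum.cong refl, simp add: index_tensor_op[of _ m _ d])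
  then show ?thesis using assms by (simp add: frobenius_sq_def sum_distrib_left)
qed

section \<open>Constant maximally mixed input and the limit argument\<close>

lemma density_op_maximally_mixed:
  assumes "d > 0"
  shows "density_op d ((1 / of_nat d) \<cdot>\<^sub>m 1\<^sub>m d)"
proof -
  have "0 \<le> ((1 / of_nat d) \<cdot>\<^sub>m 1\<^sub>m d *\<^sub>v v) \<bullet>c v" if v: "v \<in> carrier_vec d" for v :: "complex vec"
  proof -
    have "((1 / of_nat d) \<cdot>\<^sub>m 1\<^sub>m d *\<^sub>v v) = (1 / of_nat d) \<cdot>\<^sub>v v"
      using v by (intro eq_vecI) (auto simp: scalar_prod_def if_distribR if_distrib[of "\<lambda>x. x * _"]
          sum_divide_distrib[symmetric] cong: if_cong)
    then have "((1 / of_nat d) \<cdot>\<^sub>m 1\<^sub>m d *\<^sub>v v) \<bullet>c v = of_real (1 / real d) * (v \<bullet>c v)"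
      using v by simp
    also have "0 \<le> \<dots>"
      by (intro mult_nonneg_nonneg conjugate_square_ge_0_vec) (simp add: less_eq_complex_def)
    finally show ?thesis .
  qed
  then show ?thesis using assms by (auto simp: density_op_def positive_op_def trace_op_def)
qed

theorem theorem2:
  fixes d :: nat and E :: "complex mat \<Rightarrow> complex mat"
  assumes "quantum_channel d E"
    and "E (1\<^sub>m d) \<noteq> 1\<^sub>m d"
  shows "\<not> repeatable_finite_memory d E"
proof
  assume "repeatable_finite_memory d E"
  then obtain m U \<xi> where U: "unitary_op (m * d) U" and \<xi>: "density_op m \<xi>"
    and rep: "\<And>\<rho> j X. (\<And>j. density_op d (\<rho> j)) \<Longrightarrow> X \<in> carrier_mat d d \<Longrightarrow>
      induced_channel m d U \<xi> \<rho> j X = E X"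
    unfolding repeatable_finite_memory_def by blast
  have E1: "E (1\<^sub>m d) \<in> carrier_mat d d"
    using assms(1) by (simp add: quantum_channel_def linear_superop_def)
  \<comment> \<open>There is only one 0 by 0 matrix, so a nonunital channel excludes
    \<open>d = 0\<close>, and division by \<open>d\<close> is safe.\<close>
  have d: "d > 0"
  proof (rule ccontr)
    assume "\<not> d > 0"
    then have "E (1\<^sub>m d) = 1\<^sub>m d" using E1 by (intro eq_matI) auto
    with assms(2) show False by simp
  qed
  define \<rho> :: "nat \<Rightarrow> complex mat" where "\<rho> = (\<lambda>_. (1 / of_nat d) \<cdot>\<^sub>m 1\<^sub>m d)"
  define x where "x = memory_state m d U \<xi> \<rho>"
  \<comment> \<open>The input here is the identity rather than \<open>\<rho> j\<close>: then
    \<open>ptrace_M m d (Y j)\<close> is \<open>E (1\<^sub>m d)\<close> itself, while the factor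
    \<open>1 / of_nat d\<close> reappears in \<open>x_Suc\<close> as the normalization of the
    projection.\<close>
  define Y where "Y = (\<lambda>j. evolve U (x j) (1\<^sub>m d))"
  have x_carrier: "x j \<in> carrier_mat m m" for j
    using \<xi> by (cases j) (auto simp: x_def density_op_def positive_op_def ptrace_S_def)
  have Y_carrier: "Y j \<in> carrier_mat (m * d) (m * d)" for j
    using U x_carrier by (simp add: Y_def)
  have x_Suc: "x (Suc j) = (1 / of_nat d) \<cdot>\<^sub>m ptrace_S m d (Y j)" for j
  proof -
    have "x (Suc j) = ptrace_S m d (evolve U (x j) ((1 / of_nat d) \<cdot>\<^sub>m 1\<^sub>m d))"
      by (simp add: x_def \<rho>_def)
    also have "\<dots> = ptrace_S m d ((1 / of_nat d) \<cdot>\<^sub>m Y j)"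
      using evolve_smult_right[OF U x_carrier, of "1\<^sub>m d"] by (simp add: Y_def)
    finally show ?thesis using ptrace_S_smult[OF Y_carrier] by simp
  qed
  have trace_Y: "trace_op (Y j) = of_nat d * trace_op (x j)" for j
    using trace_op_unitary_conj[OF U] x_carrier
    by (simp add: Y_def evolve_def trace_op_tensor_op[of _ m _ d]) (simp add: trace_op_def)
  \<comment> \<open>Unit trace makes the partial trace over the memory of
    \<open>tensor_op (x (Suc j)) (1\<^sub>m d)\<close> equal to the identity.\<close>
  have trace_x: "trace_op (x j) = 1" for j
  proof (induction j)
    case 0
    then show ?case using \<xi> by (simp add: x_def density_op_def)
  next
    case (Suc j)
    have "trace_op (x (Suc j)) = (1 / of_nat d) * trace_op (ptrace_S m d (Y j))"
      by (simp add: x_Suc trace_op_def sum_distrib_left ptrace_S_def)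
    then show ?case using Suc d by (simp add: trace_op_ptrace_S[OF Y_carrier] trace_Y)
  qed
  define D where "D = (\<lambda>j. Y j - tensor_op (x (Suc j)) (1\<^sub>m d))"
  have D_carrier: "D j \<in> carrier_mat (m * d) (m * d)" for j
    unfolding D_def using x_carrier by (intro minus_carrier_mat tensor_op_carrier) auto
  have D_eq: "frobenius_sq (D j) = real d * (frobenius_sq (x j) - frobenius_sq (x (Suc j)))" for j
  proof -
    have "frobenius_sq (Y j) = real d * frobenius_sq (x j)"
      using frobenius_sq_unitary_conj[OF U] x_carrier
      by (simp add: Y_def evolve_def frobenius_sq_tensor_one[of _ m])
    then show ?thesis
      using frobenius_sq_diff_tensor[OF d Y_carrier, of j]
      by (simp add: D_def x_Suc algebra_simps)
  qed
  \<comment> \<open>The left side of \<open>D_eq\<close> is nonnegative and \<open>d > 0\<close>, so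
    the purity cannot grow.\<close>
  have "decseq (\<lambda>j. frobenius_sq (x j))"
  proof (rule decseq_SucI)
    fix j
    show "frobenius_sq (x (Suc j)) \<le> frobenius_sq (x j)"
      using D_eq[of j] frobenius_sq_nonneg[of "D j"] d by (simp add: zero_le_mult_iff)
  qed
  then obtain l where l: "(\<lambda>j. frobenius_sq (x j)) \<longlonglongrightarrow> l"
    using decseq_convergent[of _ 0] frobenius_sq_nonneg by metis
  \<comment> \<open>Consecutive purities share the limit \<open>l\<close>, so their difference
    vanishes in the limit.\<close>
  have D_lim: "(\<lambda>j. frobenius_sq (D j)) \<longlonglongrightarrow> 0"
    unfolding D_eq using tendsto_mult_left[OF tendsto_diff[OF l LIMSEQ_Suc[OF l]], of "real d"] by simp
  have D_entry: "(\<lambda>j. D j $$ (p, q)) \<longlonglongrightarrow> 0" if "p < m * d" "q < m * d" for p q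
  proof -
    have "(\<lambda>j. (cmod (D j $$ (p, q)))\<^sup>2) \<longlonglongrightarrow> 0"
      using that
      by (intro tendsto_sandwich[OF _ _ tendsto_const D_lim] always_eventually allI
          cmod_entry_le_frobenius_sq) (auto simp: carrier_matD[OF D_carrier])
    then show ?thesis
      by (simp add: tendsto_norm_zero_iff)
  qed
  have "E (1\<^sub>m d) $$ (s, t) = 1\<^sub>m d $$ (s, t)" if "s < d" "t < d" for s t
  proof -
    \<comment> \<open>The sum is the \<open>(s, t)\<close> entry of the partial trace of
      \<open>D j\<close> over the memory; repeatability makes it independent of
      \<open>j\<close>.\<close>
    have eq: "(\<Sum>i<m. D j $$ (i * d + s, i * d + t)) = E (1\<^sub>m d) $$ (s, t) - 1\<^sub>m d $$ (s, t)" for j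
    proof -
      have "E (1\<^sub>m d) = ptrace_M m d (Y j)"
        using rep[of \<rho> "1\<^sub>m d" j] density_op_maximally_mixed[OF d]
        by (simp add: \<rho>_def induced_channel_def Y_def x_def)
      then have "E (1\<^sub>m d) $$ (s, t) = (\<Sum>i<m. Y j $$ (i * d + s, i * d + t))"
        using that by (simp add: ptrace_M_def)
      moreover have "(\<Sum>i<m. tensor_op (x (Suc j)) (1\<^sub>m d) $$ (i * d + s, i * d + t))
          = trace_op (x (Suc j)) * 1\<^sub>m d $$ (s, t)"
        using that x_carrier[of "Suc j"]
        by (simp add: index_tensor_op[of _ m _ d] trace_op_def)
      moreover have "D j $$ (i * d + s, i * d + t)
          = Y j $$ (i * d + s, i * d + t) - tensor_op (x (Suc j)) (1\<^sub>m d) $$ (i * d + s, i * d + t)"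
        if "i < m" for i
        using that \<open>s < d\<close> \<open>t < d\<close> carrier_matD[OF tensor_op_carrier[OF x_carrier[of "Suc j"] one_carrier_mat]]
        by (simp add: D_def mult_add_less)
      ultimately show ?thesis by (simp add: sum_subtractf trace_x)
    qed
    \<comment> \<open>Finite memory enters here: the partial trace adds a fixed finite number
      \<open>m\<close> of entries, each tending to zero. By \<open>eq\<close> the sequence is
      constant, hence equal to its limit zero.\<close>
    have "(\<lambda>j. \<Sum>i<m. D j $$ (i * d + s, i * d + t)) \<longlonglongrightarrow> (\<Sum>i<m. 0)"
      using that by (intro tendsto_sum D_entry) (auto simp: mult_add_less)
    then show ?thesis unfolding eq by (simp add: LIMSEQ_const_iff)
  qed
  then have "E (1\<^sub>m d) = 1\<^sub>m d" using E1 by (intro eq_matI) auto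
  with assms(2) show False by simp
qed

end
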